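(* For all $n\geq 1$, $$\frac{\mathrm{sp}(n)-1}{2}\equiv z(n-1)\pmod 2.$$
   Context: The semi-Pell sequence $\{\mathrm{sp}(n)\}_{n\ge0}$ is defined by $\mathrm{sp}(0)=0$, $\mathrm{sp}(1)=1$, and for $n\ge1$: $\mathrm{sp}(2n)=\mathrm{sp}(n)$ and $\mathrm{sp}(2n+1)=2\,\mathrm{sp}(2n)+\mathrm{sp}(2n-1)$. (The number $\mathrm{sp}(n)$ is odd for all $n\ge1$, so the left-hand side of the claim is an integer.) The paper-folding sequence $\{z(n)\}_{n\ge0}$ (OEIS A014707) is defined for $n\ge0$ by $z(4n)=0$, $z(4n+2)=1$, and $z(2n+1)=z(n)$. *)

theory Defs
  imports "HOL-Number_Theory.Cong"
begin

function semi_pell :: "nat \<Rightarrow> int" where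
  semi_pell_0: "semi_pell 0 = 0"
| semi_pell_1: "semi_pell 1 = 1"
| semi_pell_even: "n \<ge> 1 \<Longrightarrow> semi_pell (2 * n) = semi_pell n"
| semi_pell_odd: "n \<ge> 1 \<Longrightarrow>
    semi_pell (2 * n + 1) = 2 * semi_pell (2 * n) + semi_pell (2 * n - 1)"
proof -
  fix P :: bool and x :: nat
  assume *: "x = 0 \<Longrightarrow> P" "x = 1 \<Longrightarrow> P"
    "\<And>n. 1 \<le> n \<Longrightarrow> x = 2 * n \<Longrightarrow> P"
    "\<And>n. 1 \<le> n \<Longrightarrow> x = 2 * n + 1 \<Longrightarrow> P"
  have "x = 2 * (x div 2) \<or> x = 2 * (x div 2) + 1" by presburger
  then show P using *(1) *(2) *(3)[of "x div 2"] *(4)[of "x div 2"] by force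
qed (simp_all, presburger+)
termination by (relation "measure id") auto

text \<open>OEIS A014707.\<close>

function paper_folding :: "nat \<Rightarrow> int" where
  paper_folding_4n: "paper_folding (4 * n) = 0"
| paper_folding_4n_2: "paper_folding (4 * n + 2) = 1"
| paper_folding_odd: "paper_folding (2 * n + 1) = paper_folding n"
proof -
  fix P :: bool and x :: nat
  assume *: "\<And>n. x = 4 * n \<Longrightarrow> P" "\<And>n. x = 4 * n + 2 \<Longrightarrow> P"
    "\<And>n. x = 2 * n + 1 \<Longrightarrow> P"
  have "x = 4 * (x div 4) \<or> x = 4 * (x div 4) + 2 \<or> x = 2 * (x div 2) + 1" by presburger
  then show P using * by blast
qed (presburger | simp)+
termination by (relation "measure id") auto

text \<open>Hence \<open>(semi_pell n - 1) div 2\<close> is an exact quotient for \<open>n \<ge> 1\<close>.\<close>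

lemma odd_semi_pell: "n \<ge> 1 \<Longrightarrow> odd (semi_pell n)"
proof (induction n rule: semi_pell.induct)
  case 2
  show ?case by (simp only: semi_pell_1 odd_one not_False_eq_True)
next
  case (3 n)
  then show ?case by (simp only: semi_pell_even not_False_eq_True)
next
  case (4 n)
  then have "odd (semi_pell (2 * n - 1))" by simp
  then show ?case using 4(1) by (simp only: semi_pell_odd) simp
qed simp

end

theory Submission
  imports Defs
begin

text \<open>
  Both sides are invariant under doubling \<open>n\<close>: \<open>semi_pell (2 * m) = semi_pell m\<close>, and
  \<open>2 * m - 1 = 2 * (m - 1) + 1\<close> gives \<open>paper_folding (2 * m - 1) = paper_folding (m - 1)\<close>. So only
  odd \<open>n = 2 * m + 1\<close> matter. There the right-hand side is the parity of \<open>m\<close>, while the parity of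
  \<open>(semi_pell n - 1) div 2\<close> is decided by \<open>semi_pell n\<close> modulo 4. Since every positive-index
  term is odd, the summand \<open>2 * semi_pell (2 * m)\<close> in the recurrence is 2 modulo 4, so the
  odd-indexed terms advance by 2 modulo 4, exactly as their indices do.
\<close>

lemma semi_pell_odd_index_cong: "[semi_pell (2 * m + 1) = 2 * int m + 1] (mod 4)"
proof (induction m)
  case 0
  have "semi_pell (2 * 0 + 1) = 1"
    by (simp only: mult_0_right add_0 semi_pell_1)
  then show ?case
    by (simp add: cong_def)
next
  case (Suc m)
  have "semi_pell (2 * Suc m + 1) = 2 * semi_pell (2 * Suc m) + semi_pell (2 * m + 1)"
    using semi_pell_odd[of "Suc m"] by simp
  moreover have "odd (semi_pell (2 * Suc m))"
    by (rule odd_semi_pell) simp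
  ultimately show ?case
    using Suc.IH unfolding cong_def of_nat_Suc by presburger
qed

lemma paper_folding_even_index: "paper_folding (2 * m) = int (m mod 2)"
proof (cases "even m")
  case True
  then obtain k where "m = 2 * k" ..
  then show ?thesis
    using paper_folding_4n[of k] by simp
next
  case False
  then obtain k where "m = 2 * k + 1" ..
  then show ?thesis
    using paper_folding_4n_2[of k] by simp
qed

theorem theorem6p3:
  fixes n :: nat
  assumes "n \<ge> 1"
  shows "[(semi_pell n - 1) div 2 = paper_folding (n - 1)] (mod 2)"
  using assms
proof (induction n rule: less_induct)
  case (less n)
  show ?case
  proof (cases "even n")
    case True
    then obtain m where n: "n = 2 * m" ..
    with less.prems have m: "1 \<le> m" "m < n"
      by auto
    have "n - 1 = 2 * (m - 1) + 1"
      using n m by simp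
    then have "paper_folding (n - 1) = paper_folding (m - 1)"
      by (simp only: paper_folding_odd)
    moreover have "semi_pell n = semi_pell m"
      using n m by (simp only: semi_pell_even)
    ultimately show ?thesis
      using less.IH[OF m(2,1)] by simp
  next
    case False
    then obtain m where n: "n = 2 * m + 1" ..
    then have "paper_folding (n - 1) = int m mod 2"
      using paper_folding_even_index[of m] by (simp add: zmod_int)
    moreover have "[semi_pell n = 2 * int m + 1] (mod 4)"
      unfolding n by (rule semi_pell_odd_index_cong)
    ultimately show ?thesis
      unfolding cong_def by presburger
  qed
qed

end
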